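(* Let $l,r\ge 0$ be integers and let $S$ be the $(p,m,2)$ signed graph consisting of a positive edge, to which are attached $l$ positive pendant edges and $2$ negative pendant edges at one end as well as $r$ positive pendant edges at the other end. If $l,r\geq 2$ and $r$ is even then $S$ is additively graceful.
   Context: A signed graph $S$ is a finite simple graph on $p$ vertices in which $m$ edges are specified as positive and the remaining $n$ edges are specified as negative; it is then called a $(p,m,n)$ signed graph, with sets of positive and negative edges $E^+(S)$ and $E^-(S)$. Attaching a pendant edge at a vertex $z$ means adding a new vertex of degree 1 joined to $z$. Thus $S$ has positive edges $z_1z_2$, $z_1v_i$ ($1\le i\le l$), $z_2w_i$ ($1\le i\le r$) and negative edges $z_1u_1$, $z_1u_2$, all these vertices being distinct, and no other vertices or edges. An additively graceful labeling of a $(p,m,n)$ signed graph $S=(V,E)$ is an injective map $f:V\to\{0,1,\dots,m+\lceil\frac{n+1}{2}\rceil\}$ such that, with $f^*(uv)=f(u)+f(v)$ for $uv\in E^-(S)$ and $f^*(uv)=|f(u)-f(v)|$ for $uv\in E^+(S)$, one has $\{f^*(uv):uv\in E^-(S)\}=\{1,2,\dots,n\}$ and $\{f^*(uv):uv\in E^+(S)\}=\{1,2,\dots,m\}$. $S$ is additively graceful if it admits such a labeling. *)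

theory Defs
  imports Complex_Main
begin

record 'a sgraph =
  verts :: "'a set"
  pos_edges :: "'a set set"
  neg_edges :: "'a set set"

text \<open>Edges are two-element sets of vertices; each edge of the underlying finite simple graph
  carries exactly one sign.\<close>

definition signed_graph :: "'a sgraph \<Rightarrow> bool" where
  "signed_graph S \<longleftrightarrow>
     finite (verts S) \<and>
     (\<forall>e \<in> pos_edges S \<union> neg_edges S. e \<subseteq> verts S \<and> card e = 2) \<and>
     pos_edges S \<inter> neg_edges S = {}"

definition pmn_signed_graph :: "nat \<Rightarrow> nat \<Rightarrow> nat \<Rightarrow> 'a sgraph \<Rightarrow> bool" where
  "pmn_signed_graph p m n S \<longleftrightarrow>
     signed_graph S \<and> card (verts S) = p \<and> card (pos_edges S) = m \<and> card (neg_edges S) = n"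

text \<open>A labeling is a total function of which only the values on the vertices matter. The
  differences are taken in the integers to avoid truncated subtraction.\<close>

definition additively_graceful_labeling :: "'a sgraph \<Rightarrow> ('a \<Rightarrow> nat) \<Rightarrow> bool" where
  "additively_graceful_labeling S f \<longleftrightarrow>
     (let m = card (pos_edges S); n = card (neg_edges S) in
        inj_on f (verts S) \<and>
        f ` verts S \<subseteq> {0..m + nat \<lceil>(real n + 1) / 2\<rceil>} \<and>
        {f u + f v | u v. {u, v} \<in> neg_edges S} = {1..n} \<and>
        {\<bar>int (f u) - int (f v)\<bar> | u v. {u, v} \<in> pos_edges S} = {1..int m})"

definition additively_graceful :: "'a sgraph \<Rightarrow> bool" where
  "additively_graceful S \<longleftrightarrow> (\<exists>f. additively_graceful_labeling S f)"

text \<open>A positive edge \<open>z\<^sub>1z\<^sub>2\<close> with \<open>l\<close> positive and two negative pendant edges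
  attached at \<open>z\<^sub>1\<close> and \<open>r\<close> positive pendant edges attached at \<open>z\<^sub>2\<close>. The lists
  \<open>vs\<close> and \<open>ws\<close> enumerate the ends of the positive pendant edges.\<close>

definition signed_double_star :: "nat \<Rightarrow> nat \<Rightarrow> 'a sgraph \<Rightarrow> bool" where
  "signed_double_star l r S \<longleftrightarrow>
     (\<exists>z1 z2 u1 u2 vs ws.
        length vs = l \<and> length ws = r \<and>
        distinct ([z1, z2, u1, u2] @ vs @ ws) \<and>
        verts S = set ([z1, z2, u1, u2] @ vs @ ws) \<and>
        pos_edges S = {{z1, z2}} \<union> {{z1, v} | v. v \<in> set vs} \<union> {{z2, w} | w. w \<in> set ws} \<and>
        neg_edges S = {{z1, u1}, {z1, u2}})"

lemma signed_double_star_pmn: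
  assumes "signed_double_star l r S"
  shows "pmn_signed_graph (l + r + 4) (l + r + 1) 2 S"
proof -
  from assms obtain z1 z2 u1 u2 vs ws where
    len: "length vs = l" "length ws = r" and
    d: "distinct ([z1, z2, u1, u2] @ vs @ ws)" and
    V: "verts S = set ([z1, z2, u1, u2] @ vs @ ws)" and
    P: "pos_edges S = {{z1, z2}} \<union> {{z1, v} | v. v \<in> set vs} \<union> {{z2, w} | w. w \<in> set ws}" and
    N: "neg_edges S = {{z1, u1}, {z1, u2}}"
    unfolding signed_double_star_def by (elim exE conjE)
  from d have ne: "z1 \<noteq> z2" "z1 \<noteq> u1" "z1 \<noteq> u2" "z2 \<noteq> u1" "z2 \<noteq> u2" "u1 \<noteq> u2"
    "z1 \<notin> set vs" "z2 \<notin> set vs" "u1 \<notin> set vs" "u2 \<notin> set vs"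
    "z1 \<notin> set ws" "z2 \<notin> set ws" "u1 \<notin> set ws" "u2 \<notin> set ws"
    and dv: "distinct vs" "distinct ws"
    by simp_all
  have cV: "card (verts S) = l + r + 4"
    unfolding V distinct_card[OF d] using len by simp
  have inj: "inj_on (\<lambda>y. {x, y}) X" for x :: 'a and X
    by (auto simp: inj_on_def doubleton_eq_iff)
  have A: "card ((\<lambda>v. {z1, v}) ` set vs) = l"
    using card_image[OF inj] distinct_card[OF dv(1)] len by simp
  have B: "card ((\<lambda>w. {z2, w}) ` set ws) = r"
    using card_image[OF inj] distinct_card[OF dv(2)] len by simp
  have P': "pos_edges S = insert {z1, z2} ((\<lambda>v. {z1, v}) ` set vs \<union> (\<lambda>w. {z2, w}) ` set ws)"
    unfolding P by blast
  have "(\<lambda>v. {z1, v}) ` set vs \<inter> (\<lambda>w. {z2, w}) ` set ws = {}"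
    using ne by (auto simp: doubleton_eq_iff)
  moreover have "{z1, z2} \<notin> (\<lambda>v. {z1, v}) ` set vs \<union> (\<lambda>w. {z2, w}) ` set ws"
    using ne by (auto simp: doubleton_eq_iff)
  ultimately have cP: "card (pos_edges S) = l + r + 1"
    unfolding P' using A B by (simp add: card_Un_disjoint)
  have "{z1, u1} \<noteq> {z1, u2}"
    using ne by (auto simp: doubleton_eq_iff)
  then have cN: "card (neg_edges S) = 2"
    unfolding N by simp
  have c2: "card {x, y} = 2" if "x \<noteq> y" for x y :: 'a
    using that by simp
  have "finite (verts S)"
    unfolding V by simp
  moreover have "e \<subseteq> verts S \<and> card e = 2" if e: "e \<in> pos_edges S \<union> neg_edges S" for e
  proof -
    have v: "z1 \<in> verts S" "z2 \<in> verts S" "u1 \<in> verts S" "u2 \<in> verts S"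
      "set vs \<subseteq> verts S" "set ws \<subseteq> verts S"
      unfolding V by auto
    consider "e = {z1, z2}" | "e = {z1, u1}" | "e = {z1, u2}"
      | v where "e = {z1, v}" "v \<in> set vs" | w where "e = {z2, w}" "w \<in> set ws"
      using e unfolding P' N by blast
    then have "\<exists>x y. e = {x, y} \<and> x \<noteq> y \<and> x \<in> verts S \<and> y \<in> verts S"
      by cases (use ne v in blast)+
    then show ?thesis
      using c2 by blast
  qed
  moreover have "pos_edges S \<inter> neg_edges S = {}"
    unfolding P' N using ne by (auto simp: doubleton_eq_iff)
  ultimately have "signed_graph S"
    unfolding signed_graph_def by blast
  with cV cP cN show ?thesis
    by (simp add: pmn_signed_graph_def)
qed

end

theory Submission
  imports Defs
begin

text \<open>Write \<open>m = l + r + 1\<close>. There are as many vertices as labels in \<open>{0..m + 2}\<close>, so every label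
  is used, and the sums 1 and 2 on the negative edges leave no choice but \<open>0\<close> at \<open>z\<^sub>1\<close> and
  \<open>1, 2\<close> at the ends of the negative edges. The labels \<open>3, \<dots>, m + 2\<close> remain: one, say \<open>c\<close>, for
  \<open>z\<^sub>2\<close>, a set \<open>V\<close> of \<open>l\<close> labels for the leaves at \<open>z\<^sub>1\<close> and a set \<open>W\<close> of \<open>r\<close> labels for the leaves
  at \<open>z\<^sub>2\<close>. The positive edges at \<open>z\<^sub>1\<close> receive the values \<open>c\<close> and \<open>V\<close> themselves, so the
  distances from \<open>W\<close> to \<open>c\<close> must supply the rest of \<open>{1..m}\<close>. This reduction to sets of numbers
  is \<open>signed_double_star_additively_gracefulI\<close>.

  The sets come from the choice \<open>c = m\<close>. The labels \<open>m + 1\<close> and \<open>m + 2\<close>, too large to be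
  differences, go to \<open>W\<close> and give the differences \<open>1\<close> and \<open>2\<close>, which are too small to be available
  labels. The remaining \<open>r - 2\<close> elements of \<open>W\<close> must then have distances to \<open>m\<close> that form the
  same set again, which holds when they come in pairs \<open>w, m - w\<close>; this is where the parity of
  \<open>r\<close> enters. Taking \<open>w = 3, 4, \<dots>\<close> there is room for \<open>r / 2 - 1\<close> pairs with \<open>w < m - w\<close>
  exactly because \<open>l \<ge> 2\<close>.\<close>

text \<open>A symmetric function on edges may be evaluated with the centre of a star first; this removes
  the freedom in choosing the order of the two ends.\<close>

lemma symmetric_edge_values_star:
  assumes "\<And>x y. g x y = g y x"
  shows "{g x y | x y. \<exists>v \<in> A. {x, y} = {z, v}} = g z ` A"
  using assms by (fastforce simp: doubleton_eq_iff)

text \<open>Since the leaves at a common centre are interchangeable, a labeling is determined up to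
  symmetry by the label of \<open>z\<^sub>2\<close> and the two sets of leaf labels, and any bijections from the
  leaves onto these sets will do.\<close>

lemma signed_double_star_additively_gracefulI:
  fixes S :: "'a sgraph" and V W :: "nat set" and c :: nat
  assumes star: "signed_double_star l r S"
    and fin: "finite V" "finite W"
    and card: "card V = l" "card W = r"
    and range: "insert c (V \<union> W) \<subseteq> {3..l + r + 3}"
    and disj: "V \<inter> W = {}" "c \<notin> V" "c \<notin> W"
    and diffs: "insert (int c) (int ` V \<union> (\<lambda>w. \<bar>int c - int w\<bar>) ` W) = {1..int (l + r + 1)}"
  shows "additively_graceful S"
proof -
  from star obtain z1 z2 u1 u2 vs ws where
    len: "length vs = l" "length ws = r" and
    d: "distinct ([z1, z2, u1, u2] @ vs @ ws)" and
    verts: "verts S = set ([z1, z2, u1, u2] @ vs @ ws)" and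
    pos: "pos_edges S = {{z1, z2}} \<union> {{z1, v} | v. v \<in> set vs} \<union> {{z2, w} | w. w \<in> set ws}" and
    neg: "neg_edges S = {{z1, u1}, {z1, u2}}"
    unfolding signed_double_star_def by (elim exE conjE)
  have cards: "card (pos_edges S) = l + r + 1" "card (neg_edges S) = 2"
    using signed_double_star_pmn[OF star] by (simp_all add: pmn_signed_graph_def)
  have "card (set vs) = card V" "card (set ws) = card W"
    using d len card by (simp_all add: distinct_card)
  then obtain g h where g: "bij_betw g (set vs) V" and h: "bij_betw h (set ws) W"
    using fin finite_same_card_bij[of "set vs" V] finite_same_card_bij[of "set ws" W] by auto
  define f where "f x = (if x = z1 then 0 else if x = z2 then c else if x = u1 then 1
    else if x = u2 then 2 else if x \<in> set vs then g x else h x)" for x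
  have f_ends: "f z1 = 0" "f z2 = c" "f u1 = 1" "f u2 = 2"
    using d by (auto simp: f_def)
  have fv: "f x = g x" if "x \<in> set vs" for x
    using d that by (auto simp: f_def)
  have fw: "f x = h x" if "x \<in> set ws" for x
    using d that by (auto simp: f_def)
  have bv: "bij_betw f (set vs) V"
    using g fv by (simp cong: bij_betw_cong)
  have bw: "bij_betw f (set ws) W"
    using h fw by (simp cong: bij_betw_cong)
  have img: "f ` set vs = V" "f ` set ws = W"
    using bv bw by (simp_all add: bij_betw_def)
  have inj: "inj_on f (set vs)" "inj_on f (set ws)"
    using bv bw by (simp_all add: bij_betw_def)
  have verts': "verts S = {z1, z2, u1, u2} \<union> (set vs \<union> set ws)"
    unfolding verts by auto
  have "inj_on f (set vs \<union> set ws)"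
    using inj img disj(1) by (auto simp: inj_on_Un)
  moreover have "inj_on f {z1, z2, u1, u2}"
    using range by (auto simp: f_ends)
  moreover have "f ` {z1, z2, u1, u2} \<inter> f ` (set vs \<union> set ws) = {}"
    unfolding image_Un img using range disj by (auto simp: f_ends)
  ultimately have f_inj: "inj_on f (verts S)"
    unfolding verts' by (subst inj_on_Un) blast
  have f_range: "f ` verts S \<subseteq> {0..l + r + 1 + 2}"
    unfolding verts' image_Un img using range by (auto simp: f_ends)
  have "{f u + f v | u v. {u, v} \<in> neg_edges S}
      = {f u + f v | u v. \<exists>w \<in> {u1, u2}. {u, v} = {z1, w}}"
    unfolding neg by simp
  also have "\<dots> = (\<lambda>v. f z1 + f v) ` {u1, u2}"
    by (rule symmetric_edge_values_star) simp
  also have "\<dots> = {1..2}"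
    by (auto simp: f_ends)
  finally have neg_vals: "{f u + f v | u v. {u, v} \<in> neg_edges S} = {1..2}" .
  let ?D = "\<lambda>u v. \<bar>int (f u) - int (f v)\<bar>"
  have "{?D u v | u v. {u, v} \<in> pos_edges S}
      = {?D u v | u v. \<exists>w \<in> insert z2 (set vs). {u, v} = {z1, w}}
        \<union> {?D u v | u v. \<exists>w \<in> set ws. {u, v} = {z2, w}}"
    unfolding pos by blast
  also have "\<dots> = ?D z1 ` insert z2 (set vs) \<union> ?D z2 ` set ws"
    by (intro arg_cong2[of _ _ _ _ "(\<union>)"] symmetric_edge_values_star) simp_all
  also have "\<dots> = insert (int c) (int ` f ` set vs \<union> (\<lambda>w. \<bar>int c - int w\<bar>) ` f ` set ws)"
    by (simp add: f_ends image_image)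
  also have "\<dots> = {1..int (l + r + 1)}"
    unfolding img by (rule diffs)
  finally have pos_vals: "{?D u v | u v. {u, v} \<in> pos_edges S} = {1..int (l + r + 1)}" .
  have "\<lceil>(real 2 + 1) / 2\<rceil> = 2"
    by (simp add: ceiling_eq_iff)
  then have "additively_graceful_labeling S f"
    unfolding additively_graceful_labeling_def Let_def cards
    using f_inj f_range neg_vals pos_vals by simp
  then show ?thesis
    unfolding additively_graceful_def by blast
qed

theorem theorem4p7:
  fixes S :: "'a sgraph" and l r p m :: nat
  assumes "pmn_signed_graph p m 2 S"
    and "signed_double_star l r S"
    and "l \<ge> 2" and "r \<ge> 2" and "even r"
  shows "additively_graceful S"
proof -
  \<comment> \<open>\<open>k\<close> is the number of pairs \<open>w, m - w\<close>, so that \<open>m = l + 2 * k + 3\<close>.\<close>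
  from \<open>even r\<close> \<open>r \<ge> 2\<close> obtain k where r: "r = 2 * k + 2"
    by (intro that[of "r div 2 - 1"]) presburger
  let ?c = "l + 2 * k + 3"
  let ?V = "{k + 3..l + k} \<union> {l + 2 * k + 1, l + 2 * k + 2}"
  \<comment> \<open>The first two intervals are exchanged by \<open>w \<mapsto> m - w\<close>.\<close>
  let ?W = "{3..k + 2} \<union> {l + k + 1..l + 2 * k} \<union> {l + 2 * k + 4, l + 2 * k + 5}"
  have cV: "card ?V = l"
    using \<open>l \<ge> 2\<close> by (subst card_Un_disjoint) auto
  have cW: "card ?W = r"
    using \<open>l \<ge> 2\<close> unfolding r by (subst card_Un_disjoint, simp, simp, force)+ simp
  have "insert (int ?c) (int ` ?V \<union> (\<lambda>w. \<bar>int ?c - int w\<bar>) ` ?W) = {1..int (l + r + 1)}"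
    (is "?L = ?R")
  proof (rule antisym)
    show "?L \<subseteq> ?R"
      using \<open>l \<ge> 2\<close> unfolding r by auto
  next
    show "?R \<subseteq> ?L"
    proof
      fix d assume "d \<in> ?R"
      then obtain n where d: "d = int n" and n: "1 \<le> n" "n \<le> ?c"
        unfolding r by (intro that[of "nat d"]) auto
      then consider "n = ?c" | "n \<in> ?V" | "n \<le> 2" | "n \<in> {3..k + 2} \<union> {l + k + 1..l + 2 * k}"
        by fastforce
      then show "d \<in> ?L"
      proof cases
        case 3
        then have "?c + n \<in> ?W" using n by auto
        moreover have "d = \<bar>int ?c - int (?c + n)\<bar>" using d by simp
        ultimately show ?thesis by blast
      next
        case 4
        then have "?c - n \<in> ?W" using \<open>l \<ge> 2\<close> by auto
        moreover have "d = \<bar>int ?c - int (?c - n)\<bar>" using d n by (simp add: of_nat_diff)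
        ultimately show ?thesis by blast
      qed (use d in blast)+
    qed
  qed
  moreover have "insert ?c (?V \<union> ?W) \<subseteq> {3..l + r + 3}"
    using \<open>l \<ge> 2\<close> unfolding r by auto
  moreover have "?V \<inter> ?W = {}" "?c \<notin> ?V" "?c \<notin> ?W"
    using \<open>l \<ge> 2\<close> by auto
  ultimately show ?thesis
    using signed_double_star_additively_gracefulI[OF assms(2) _ _ cV cW, of ?c] by blast
qed

end
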